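(* Let $$p(x) = 2\lambda \pi x \tan\!\left(\frac{\pi x}{2}\right) + \frac{\pi^2}{4} - (2\lambda + 4\lambda^2 x^2)$$ and let the real number $\lambda$ satisfy $$0 \le \lambda \le \lambda_0 = \frac{1}{8}\left( (4+\pi^2) - (16+\pi^4)^{1/2} \right).$$ If $f$ is an analytic function in $\Delta$ satisfying $$| Sf(z) | \le 2 p( |z| ) , \qquad z \in \Delta ,$$ then $f$ is univalent in $\Delta$, and the univalence criterion $|Sf(z)|\le 2p(|z|)$, $z\in\Delta$, is sharp.
   Context: $\Delta=\{z\in\mathbb{C}: |z|<1\}$ is the open unit disc. For an analytic locally univalent function $f$, the Schwarzian derivative is $Sf = \left(\frac{f''}{f'}\right)' - \frac12\left(\frac{f''}{f'}\right)^2$; a hypothesis on $Sf$ in $\Delta$ presupposes that $f$ is locally univalent in $\Delta$. Univalent means injective. The formula for $p$ is also used for complex argument $z\in\Delta$. The univalence criterion $|Sf(z)|\le 2p(|z|)$, $z\in\Delta$, is called sharp if, for analytic (locally univalent) $f$ in $\Delta$, the conditions $Sf(x)\ge 2p(x)$ for $-1<x<1$ (in particular $Sf(x)$ is real there) and $Sf(z)\not\equiv 2p(z)$ imply that $f$ is not univalent in $\Delta$. *)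

theory Defs
  imports "HOL-Complex_Analysis.Complex_Analysis"
begin

definition locally_univalent_on :: "(complex \<Rightarrow> complex) \<Rightarrow> complex set \<Rightarrow> bool" where
  "locally_univalent_on f S \<longleftrightarrow> (\<forall>z\<in>S. \<exists>U. open U \<and> z \<in> U \<and> inj_on f (U \<inter> S))"

(* Meaningful only at points where f is analytic and locally univalent. Elsewhere deriv and
   division by zero take junk values, so uses of this function carry both hypotheses. *)
definition schwarzian :: "(complex \<Rightarrow> complex) \<Rightarrow> complex \<Rightarrow> complex" where
  "schwarzian f z =
     deriv (\<lambda>w. deriv (deriv f) w / deriv f w) z - (1/2) * (deriv (deriv f) z / deriv f z)^2"

(* Polymorphic, so that the same formula serves real arguments (the bound at the modulus of z
   and on the interval) and complex arguments in the disc. It equals -u''/u for the function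
   u x = exp (lam * x^2) * cos (pi * x / 2). *)
definition schwarz_majorant :: "real \<Rightarrow> 'a::{real_normed_field,banach} \<Rightarrow> 'a" where
  "schwarz_majorant lam x =
     2 * of_real lam * of_real pi * x * tan (of_real pi * x / 2) + (of_real pi)^2 / 4
       - (2 * of_real lam + 4 * (of_real lam)^2 * x^2)"

(* The inequality between Sf x and 2 p x presupposes that Sf x is real, hence the first
   conjunct in the condition on the interval. *)
definition sharp_univalence_criterion :: "real \<Rightarrow> bool" where
  "sharp_univalence_criterion lam \<longleftrightarrow>
     (\<forall>f. f analytic_on ball 0 1 \<longrightarrow>
          locally_univalent_on f (ball 0 1) \<longrightarrow>
          (\<forall>x::real. -1 < x \<and> x < 1 \<longrightarrow>
             schwarzian f (of_real x) \<in> \<real> \<and>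
             Re (schwarzian f (of_real x)) \<ge> 2 * schwarz_majorant lam x) \<longrightarrow>
          (\<exists>z\<in>ball 0 1. schwarzian f z \<noteq> 2 * schwarz_majorant lam z) \<longrightarrow>
          \<not> inj_on f (ball 0 1))"

end

theory Submission imports Defs begin

text \<open>Write \<open>p\<close> for the majorant. It is built so that \<open>u'' + p u = 0\<close> has the solution
\<open>u x = exp (\<lambda> x\<^sup>2) cos (\<pi> x / 2)\<close>, which is positive on \<open>(-1, 1)\<close> and vanishes to first order at both
ends. On the other side, if \<open>s\<^sup>2 f' = 1\<close> then the functions \<open>(A f + B) s\<close> are the solutions of
\<open>v'' + (Sf / 2) v = 0\<close> (\<open>schwarzian_square_root\<close>, \<open>schwarzian_linear_solution\<close>). Hence \<open>f a = f b\<close> for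
some \<open>a \<noteq> b\<close> exactly when a nontrivial solution vanishes at two points, and both claims compare the
zeros of this equation with those of \<open>u\<close>.

Univalence. Suppose that a nontrivial solution vanishes at \<open>a\<close> and \<open>b\<close>. The hyperbolic geodesic through
\<open>a\<close> and \<open>b\<close> is the image of \<open>(-1, 1)\<close> under a disc automorphism \<open>\<gamma>\<close> that sends \<open>0\<close> to the point of the
geodesic closest to the origin, so \<open>|x| \<le> |\<gamma> x|\<close> (\<open>geodesic_through_two_points\<close>,
\<open>geodesic_conformal\<close>). Transported to \<open>(-1, 1)\<close>, the equation gets the coefficient
\<open>q = (Sf \<circ> \<gamma>) (\<gamma>')\<^sup>2 / 2\<close>, where \<open>|\<gamma>' x| = (1 - |\<gamma> x|\<^sup>2) / (1 - x\<^sup>2)\<close>. Since \<open>(1 - x\<^sup>2)\<^sup>2 p x\<close>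
decreases on \<open>[0, 1)\<close> (\<open>invariant_majorant_antimono\<close>), it follows that \<open>|q x| \<le> p x\<close>; but then a
Sturm comparison with \<open>u\<close> allows no two zeros, although \<open>q\<close> is complex valued
(\<open>no_two_zeros_if_majorized\<close>). The monotonicity is where the bound on \<open>\<lambda>\<close> comes from: the coefficient of
\<open>x\<^sup>2\<close> in \<open>(1 - x\<^sup>2)\<^sup>2 p x\<close> is \<open>\<lambda> \<pi>\<^sup>2 - 4 \<lambda>\<^sup>2 + 4 \<lambda> - \<pi>\<^sup>2 / 2\<close>, and \<open>\<lambda>\<^sub>0\<close> is its smaller root.

Sharpness. If \<open>Sf \<ge> 2 p\<close> on \<open>(-1, 1)\<close> and \<open>Sf\<close> is not identically \<open>2 p\<close>, the identity theorem gives a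
real \<open>x\<^sub>0\<close> with \<open>Sf x\<^sub>0 > 2 p x\<^sub>0\<close>. Let \<open>v\<close> be the solution with the value and the slope of \<open>u\<close> at \<open>x\<^sub>0\<close>.
The integral of \<open>1 / u\<^sup>2\<close> diverges at both ends, so the strict inequality at \<open>x\<^sub>0\<close> is enough to force
a zero of \<open>v\<close> on each side of \<open>x\<^sub>0\<close> (\<open>zero_to_the_right\<close>), and \<open>f\<close> is not injective.\<close>

section \<open>The comparison solution and its potential\<close>

definition comparison_solution :: "real \<Rightarrow> real \<Rightarrow> real" where
  "comparison_solution lam x = exp (lam * x^2) * cos (pi * x / 2)"

definition comparison_slope :: "real \<Rightarrow> real \<Rightarrow> real" where
  "comparison_slope lam x =
     exp (lam * x^2) * (2 * lam * x * cos (pi * x / 2) - pi / 2 * sin (pi * x / 2))"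

lemma cos_half_pi_pos:
  fixes x :: real
  assumes "\<bar>x\<bar> < 1"
  shows "cos (pi * x / 2) > 0"
proof (rule cos_gt_zero_pi)
  have "pi * x < pi * 1" by (rule mult_strict_left_mono) (use assms in auto)
  then show "pi * x / 2 < pi / 2" by simp
  have "pi * (-1) < pi * x" by (rule mult_strict_left_mono) (use assms in auto)
  then show "- (pi / 2) < pi * x / 2" by simp
qed

lemma comparison_solution_pos: "\<bar>x\<bar> < 1 \<Longrightarrow> comparison_solution lam x > 0"
  by (simp add: comparison_solution_def cos_half_pi_pos)

lemma comparison_solution_deriv:
  "(comparison_solution lam has_real_derivative comparison_slope lam x) (at x)"
  unfolding comparison_solution_def[abs_def] comparison_slope_def
  by (auto intro!: derivative_eq_intros simp: algebra_simps)

lemma comparison_slope_deriv: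
  assumes "\<bar>x\<bar> < 1"
  shows "(comparison_slope lam has_real_derivative
           - schwarz_majorant lam x * comparison_solution lam x) (at x)"
proof -
  have "cos (pi * x / 2) \<noteq> 0" using cos_half_pi_pos[OF assms] by simp
  then have t: "tan (pi * x / 2) * cos (pi * x / 2) = sin (pi * x / 2)"
    by (simp add: tan_def)
  have "- schwarz_majorant lam x * comparison_solution lam x =
     exp (lam * x^2) * (- (2 * lam * pi * x * (tan (pi * x / 2) * cos (pi * x / 2)))
        - pi^2 / 4 * cos (pi * x / 2) + (2 * lam + 4 * lam^2 * x^2) * cos (pi * x / 2))"
    unfolding schwarz_majorant_def comparison_solution_def
    by (simp add: algebra_simps)
  also have "\<dots> = exp (lam * x^2) * (- (2 * lam * pi * x * sin (pi * x / 2))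
        - pi^2 / 4 * cos (pi * x / 2) + (2 * lam + 4 * lam^2 * x^2) * cos (pi * x / 2))"
    by (simp only: t)
  finally have eq: "- schwarz_majorant lam x * comparison_solution lam x = \<dots>" .
  show ?thesis
    unfolding eq comparison_slope_def[abs_def]
    by (auto intro!: derivative_eq_intros simp: algebra_simps power2_eq_square)
qed

lemma comparison_solution_even: "comparison_solution lam (-x) = comparison_solution lam x"
  by (simp add: comparison_solution_def)

lemma comparison_slope_odd: "comparison_slope lam (-x) = - comparison_slope lam x"
  by (simp add: comparison_slope_def algebra_simps)

lemma schwarz_majorant_even:
  "schwarz_majorant lam (-x :: real) = schwarz_majorant lam x"
  by (simp add: schwarz_majorant_def)

text \<open>This bound makes the integral of the inverse square of the comparison solution diverge at \<open>1\<close>.\<close>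

lemma comparison_solution_le_linear:
  assumes "0 \<le> lam" "\<bar>x\<bar> < 1"
  shows "comparison_solution lam x \<le> (exp lam * pi / 2) * (1 - x)"
proof -
  have "cos (pi * x / 2) = sin (pi / 2 * (1 - x))"
    by (simp add: cos_sin_eq right_diff_distrib diff_divide_distrib)
  also have "\<dots> \<le> pi / 2 * (1 - x)"
    by (rule sin_x_le_x) (use assms in auto)
  finally have c: "cos (pi * x / 2) \<le> pi / 2 * (1 - x)" .
  have "x^2 \<le> 1" using assms by (simp add: abs_square_le_1)
  then have "lam * x^2 \<le> lam" using assms by (simp add: mult_left_le)
  then have e: "exp (lam * x^2) \<le> exp lam" by simp
  have "comparison_solution lam x \<le> exp lam * (pi / 2 * (1 - x))"
    unfolding comparison_solution_def
    by (rule mult_mono[OF e c]) (use cos_half_pi_pos[OF assms(2)] in auto)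
  then show ?thesis by (simp add: algebra_simps)
qed

section \<open>Monotonicity of the invariant majorant\<close>

text \<open>This is the Becker--Stark inequality \<open>tan t / t \<le> \<pi>\<^sup>2 / (\<pi>\<^sup>2 - 4 t\<^sup>2)\<close> at \<open>t = \<pi> x / 2\<close>, cleared of
denominators. In this form the difference of the two sides vanishes at \<open>0\<close> and \<open>1\<close>, and its derivative
is \<open>x\<close> times a concave function vanishing at \<open>0\<close>. Such a function changes sign at most once, from plus to
minus, so the difference first grows and then falls, and stays nonnegative.\<close>

lemma one_minus_square_mult_sin_le:
  fixes x :: real
  assumes "0 \<le> x" "x \<le> 1"
  shows "(1 - x^2) * sin (pi * x / 2) \<le> pi * x / 2 * cos (pi * x / 2)"
proof (cases "x = 0")
  case False
  then have x: "0 < x" using assms by simp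
  define g where "g t = pi * t / 2 * cos (pi * t / 2) - (1 - t^2) * sin (pi * t / 2)" for t
  define k where "k t = (2 - pi^2/4) * sin (pi * t / 2) + pi / 2 * t * cos (pi * t / 2)" for t
  define k1 where
    "k1 t = pi/2 * (3 - pi^2/4) * cos (pi * t / 2) - pi^2/4 * t * sin (pi * t / 2)" for t
  define k2 where
    "k2 t = - (pi^2/4) * (4 - pi^2/4) * sin (pi * t / 2) - pi^3/8 * t * cos (pi * t / 2)" for t
  have dg: "(g has_real_derivative t * k t) (at t)" for t
    unfolding g_def[abs_def] k_def
    by (auto intro!: derivative_eq_intros simp: field_simps power2_eq_square)
  have dk: "(k has_real_derivative k1 t) (at t)" for t
    unfolding k_def[abs_def] k1_def
    by (auto intro!: derivative_eq_intros simp: field_simps power2_eq_square)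
  have dk1: "(k1 has_real_derivative k2 t) (at t)" for t
    unfolding k1_def[abs_def] k2_def
    by (auto intro!: derivative_eq_intros simp: algebra_simps power2_eq_square power3_eq_cube)
  have pi2: "pi^2 \<le> 10"
  proof -
    have "pi^2 \<le> 3.15^2" by (rule power_mono) (use pi_approx in auto)
    then show ?thesis by (simp add: power2_eq_square)
  qed
  have k2: "k2 t \<le> 0" if "t \<in> {0..1}" for t
  proof -
    have "pi * t \<le> pi * 1" by (rule mult_left_mono) (use that in auto)
    then have "sin (pi * t / 2) \<ge> 0" "cos (pi * t / 2) \<ge> 0"
      using that pi_gt_zero by (auto intro!: sin_ge_zero cos_ge_zero intro: order_trans[of _ 0])
    then have "(pi^2/4) * (4 - pi^2/4) * sin (pi * t / 2) \<ge> 0"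
      "pi^3/8 * t * cos (pi * t / 2) \<ge> 0"
      using that pi2 by (auto intro!: mult_nonneg_nonneg)
    then show ?thesis unfolding k2_def by linarith
  qed
  have conv: "convex_on {0..1} (\<lambda>t. - k t)"
    by (rule f''_ge0_imp_convex[where f' = "\<lambda>t. - k1 t" and f'' = "\<lambda>t. - k2 t"])
       (use dk dk1 k2 in \<open>auto intro!: DERIV_minus\<close>)
  \<comment> \<open>As \<open>k 0 = 0\<close>, concavity makes \<open>k t / t\<close> nonincreasing, so the sign of \<open>k x\<close> fixes the sign of \<open>k\<close>
     on \<open>[0, x]\<close> if it is plus and on \<open>[x, 1]\<close> if it is minus.\<close>
  have chord: "a * k b \<le> b * k a" if "0 \<le> a" "a \<le> b" "0 < b" "b \<le> 1" for a b
  proof -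
    have "- k ((1 - a/b) *\<^sub>R 0 + (a/b) *\<^sub>R b) \<le> (1 - a/b) * (- k 0) + (a/b) * (- k b)"
      by (rule convex_onD[OF conv]) (use that in auto)
    moreover have "k 0 = 0" by (simp add: k_def)
    ultimately have "a / b * k b \<le> k a" using that by simp
    then show ?thesis using that by (simp add: field_simps)
  qed
  have "g x \<ge> 0"
  proof (cases "k x \<ge> 0")
    case True
    have "g 0 \<le> g x"
    proof (rule DERIV_nonneg_imp_nondecreasing[where f = g])
      fix t assume t: "0 \<le> t" "t \<le> x"
      have "0 \<le> t * k x" using t True by simp
      also have "\<dots> \<le> x * k t" using chord[of t x] t x assms by simp
      finally have "0 \<le> k t" using x by (simp add: zero_le_mult_iff)
      then show "\<exists>y. (g has_real_derivative y) (at t) \<and> 0 \<le> y" using dg t by force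
    qed (use x in auto)
    then show ?thesis by (simp add: g_def)
  next
    case False
    have "g x \<ge> g 1"
    proof (rule DERIV_nonpos_imp_nonincreasing[where f = g])
      fix t assume t: "x \<le> t" "t \<le> 1"
      have "x * k t \<le> t * k x" using chord[of x t] t x assms by simp
      also have "\<dots> \<le> 0" using False t x by (simp add: mult_nonneg_nonpos)
      finally have "k t \<le> 0" using x by (simp add: mult_le_0_iff)
      then show "\<exists>y. (g has_real_derivative y) (at t) \<and> y \<le> 0"
        using dg t x by (intro exI[of _ "t * k t"]) (auto simp: mult_nonneg_nonpos)
    qed (use assms in auto)
    then show ?thesis by (simp add: g_def)
  qed
  then show ?thesis by (simp add: g_def)
qed simp

text \<open>The parameter range ends at the smaller root of \<open>8 \<lambda>\<^sup>2 - (2 \<pi>\<^sup>2 + 8) \<lambda> + \<pi>\<^sup>2\<close>; the second inequality is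
the monotonicity condition at the origin for the majorant. The first one holds because \<open>\<pi>\<^sup>2 \<ge> 9.6\<close>; it
is what carries the condition at the origin over to the whole interval.\<close>

lemma parameter_bounds:
  fixes lam :: real
  assumes "lam \<le> (1/8) * ((4 + pi^2) - sqrt (16 + pi^4))"
  shows "24 * lam \<le> pi^2" and "lam * (2 * pi^2 + 8) \<le> 8 * lam^2 + pi^2"
proof -
  have pi2: "9.6 \<le> pi^2"
  proof -
    have "3.1^2 \<le> pi^2" by (rule power_mono) (use pi_approx in auto)
    then show ?thesis by (simp add: power2_eq_square)
  qed
  have p4: "pi^4 = (pi^2)^2" by simp
  have s: "sqrt (16 + pi^4) \<le> 4 + pi^2 - 8 * lam" using assms by simp
  have "4 + 2 * pi^2 / 3 \<le> sqrt (16 + pi^4)"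
  proof (rule real_le_rsqrt)
    have "9.6 * pi^2 \<le> pi^2 * pi^2" using pi2 by (intro mult_right_mono) auto
    then show "(4 + 2 * pi^2 / 3)^2 \<le> 16 + pi^4"
      unfolding p4 by (simp add: power2_eq_square field_simps)
  qed
  then show "24 * lam \<le> pi^2" using s by linarith
  have "16 + pi^4 \<le> (4 + pi^2 - 8 * lam)^2"
    by (rule sqrt_le_D[OF s])
  then show "lam * (2 * pi^2 + 8) \<le> 8 * lam^2 + pi^2"
    unfolding p4 by (simp add: power2_eq_square algebra_simps)
qed

text \<open>The expression is \<open>p\<close>, as a quadratic differential, measured in the hyperbolic metric. The sign of its
derivative is that of \<open>(1 - t\<^sup>2) p' - 4 t p\<close>, a quadratic polynomial in \<open>T = tan (\<pi> t / 2)\<close>. Writing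
\<open>T = (\<pi> t / 2) b / (1 - t\<^sup>2)\<close>, where \<open>0 \<le> b \<le> 1\<close> by the bound on the tangent, collects the singularity
at \<open>t = 1\<close> in a single term, which is nonpositive; the other terms are bounded one by one.\<close>

lemma invariant_majorant_antimono:
  fixes lam x y :: real
  assumes l0: "0 \<le> lam" and l: "lam \<le> (1/8) * ((4 + pi^2) - sqrt (16 + pi^4))"
    and xy: "0 \<le> x" "x \<le> y" "y < 1"
  shows "(1 - y^2)^2 * schwarz_majorant lam y \<le> (1 - x^2)^2 * schwarz_majorant lam x"
proof (rule DERIV_nonpos_imp_nonincreasing[OF xy(2)])
  fix t assume "x \<le> t" "t \<le> y"
  then have t: "0 \<le> t" "t < 1" using xy by auto
  define c s T where "c = cos (pi * t / 2)" and "s = sin (pi * t / 2)" and "T = tan (pi * t / 2)"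
  have c: "c > 0" unfolding c_def using cos_half_pi_pos t by simp
  have s: "s \<ge> 0" unfolding s_def
  proof (rule sin_ge_zero)
    have "pi * t \<le> pi * 1" by (rule mult_left_mono) (use t in auto)
    then show "pi * t / 2 \<le> pi" using pi_gt_zero by linarith
  qed (use t in auto)
  have T: "T = s / c" by (simp add: T_def s_def c_def tan_def)
  have sec: "inverse (c^2) = 1 + T^2"
    unfolding T using c sin_cos_squared_add[of "pi * t / 2"]
    by (simp add: c_def s_def field_simps)
  have m: "1 - t^2 > 0" using t by (simp add: abs_square_less_1)
  have T0: "T \<ge> 0" using s c by (simp add: T)
  have TU: "(1 - t^2) * T \<le> pi * t / 2"
    using one_minus_square_mult_sin_le[of t] t c unfolding T c_def[symmetric] s_def[symmetric]
    by (simp add: field_simps)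
  define P' where "P' = 2 * lam * pi * T + lam * pi^2 * t * (1 + T^2) - 8 * lam^2 * t"
  define D where "D = (1 - t^2) * ((1 - t^2) * P' - 4 * t * schwarz_majorant lam t)"
  have dp: "(schwarz_majorant lam has_real_derivative P') (at t)"
    unfolding schwarz_majorant_def[abs_def] P'_def
    using c sec unfolding c_def T_def
    by (auto intro!: derivative_eq_intros simp: algebra_simps power2_eq_square)
  have dF: "((\<lambda>t. (1 - t^2)^2 * schwarz_majorant lam t) has_real_derivative D) (at t)"
    unfolding D_def
    by (auto intro!: derivative_eq_intros dp simp: algebra_simps power2_eq_square)
  define b where "b = 2 * ((1 - t^2) * T) / (pi * t)"
  have core: "(1 - t^2) * P' - 4 * t * schwarz_majorant lam t \<le> 0"
  proof (cases "t = 0")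
    case True
    then show ?thesis by (simp add: P'_def T_def)
  next
    case False
    then have tp: "t > 0" using t by simp
    have b: "0 \<le> b" "b \<le> 1"
      unfolding b_def using TU T0 m tp by (simp_all add: divide_le_eq)
    have Tb: "T = pi * t / 2 * b / (1 - t^2)"
      unfolding b_def using m tp by (simp add: field_simps)
    \<comment> \<open>The singular term has a favourable sign because \<open>b \<le> 1\<close> and \<open>\<pi>\<^sup>2 < 16\<close>.\<close>
    have "pi^2 * b \<le> 16"
    proof -
      have "pi^2 \<le> 4^2" by (rule power_mono) (use pi_approx in auto)
      moreover have "pi^2 * b \<le> pi^2" using b by (simp add: mult_left_le)
      moreover have "(4::real)^2 = 16" by simp
      ultimately show ?thesis by linarith
    qed
    then have "pi^2 * b * (pi^2 * b - 16) \<le> 0"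
      using b by (intro mult_nonneg_nonpos) auto
    then have q: "t^2 * (pi^2 * b * (pi^2 * b - 16)) / (4 * (1 - t^2)) \<le> 0"
      using m by (intro divide_nonpos_pos mult_nonneg_nonpos[OF zero_le_power2]) auto
    have "pi^2 * b \<le> pi^2" using b by (simp add: mult_left_le)
    moreover have "t^2 * (24 * lam) \<le> t^2 * pi^2"
      by (rule mult_left_mono[OF parameter_bounds(1)[OF l]]) simp
    ultimately have E: "pi^2 * b + pi^2 * (1 - t^2)
        + t^2 * (pi^2 * b * (pi^2 * b - 16)) / (4 * (1 - t^2)) + 24 * lam * t^2 \<le> 2 * pi^2"
      using q unfolding right_diff_distrib[of "pi^2"] mult_1_right mult.commute[of "t^2" "pi^2"]
        mult.commute[of "t^2" "24 * lam"] by linarith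
    define R where "R = pi^2 * b + pi^2 * (1 - t^2)
        + t^2 * (pi^2 * b * (pi^2 * b - 16)) / (4 * (1 - t^2))"
    have R: "t * R = (1 - t^2) * (2 * pi * T + pi^2 * t * (1 + T^2)) - 8 * pi * t^2 * T"
    proof -
      have "t * (pi^2 * b + pi^2 * u + t^2 * (pi^2 * b * (pi^2 * b - 16)) / (4 * u))
        = u * (2 * pi * (pi * t / 2 * b / u) + pi^2 * t * (1 + (pi * t / 2 * b / u)^2))
            - 8 * pi * t^2 * (pi * t / 2 * b / u)" if "u > 0" for u :: real
        using that by (simp add: field_simps power2_eq_square)
      from this[OF m] show ?thesis unfolding R_def Tb .
    qed
    have "(1 - t^2) * P' - 4 * t * schwarz_majorant lam t
        = lam * ((1 - t^2) * (2 * pi * T + pi^2 * t * (1 + T^2)) - 8 * pi * t^2 * T)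
            + t * (8 * lam + 24 * lam^2 * t^2 - 8 * lam^2 - pi^2)"
      unfolding P'_def schwarz_majorant_def T_def[symmetric]
      by (simp add: T_def) (simp add: algebra_simps power2_eq_square)
    also have "\<dots> = t * (lam * (R + 24 * lam * t^2 + 8) - 8 * lam^2 - pi^2)"
      unfolding R[symmetric] by (simp add: algebra_simps power2_eq_square)
    also have "\<dots> \<le> 0"
    proof (rule mult_nonneg_nonpos)
      have "lam * (R + 24 * lam * t^2 + 8) \<le> lam * (2 * pi^2 + 8)"
        by (rule mult_left_mono) (use E l0 R_def in auto)
      then show "lam * (R + 24 * lam * t^2 + 8) - 8 * lam^2 - pi^2 \<le> 0"
        using parameter_bounds(2)[OF l] by linarith
    qed (use t in auto)
    finally show ?thesis .
  qed
  have "D \<le> 0"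
    unfolding D_def by (rule mult_nonneg_nonpos[OF _ core]) (use m in auto)
  then show "\<exists>y. ((\<lambda>t. (1 - t^2)^2 * schwarz_majorant lam t) has_real_derivative y) (at t) \<and> y \<le> 0"
    using dF by blast
qed

section \<open>Two comparison principles on the line\<close>

text \<open>With \<open>N = |w / y|\<^sup>2\<close> one has \<open>y\<^sup>2 N' = 2 \<Phi>\<close> and
\<open>\<Phi>' = |w' - (y' / y) w|\<^sup>2 + p |w|\<^sup>2 - Re (q |w|\<^sup>2) \<ge> 0\<close>. So \<open>\<Phi>\<close> increases from \<open>0\<close> at one zero of \<open>w\<close> to \<open>0\<close> at
the other; it vanishes identically, \<open>N\<close> is constant, and \<open>N a = 0\<close>. This is Picone's identity;
only the real part of \<open>q\<close> enters it, so complex coefficients do no harm.\<close>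

lemma no_two_zeros_if_majorized:
  fixes w w1 q :: "real \<Rightarrow> complex" and y y1 p :: "real \<Rightarrow> real"
  assumes ab: "a < b"
    and dw: "\<And>x. x \<in> {a..b} \<Longrightarrow> (w has_vector_derivative w1 x) (at x)"
    and dw1: "\<And>x. x \<in> {a..b} \<Longrightarrow> (w1 has_vector_derivative - q x * w x) (at x)"
    and dy: "\<And>x. x \<in> {a..b} \<Longrightarrow> (y has_real_derivative y1 x) (at x)"
    and dy1: "\<And>x. x \<in> {a..b} \<Longrightarrow> (y1 has_real_derivative - p x * y x) (at x)"
    and y: "\<And>x. x \<in> {a..b} \<Longrightarrow> y x > 0"
    and qp: "\<And>x. x \<in> {a..b} \<Longrightarrow> cmod (q x) \<le> p x"
    and zeros: "w a = 0" "w b = 0"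
    and x: "x \<in> {a..b}"
  shows "w x = 0"
proof -
  define \<Phi> where "\<Phi> t = w t \<bullet> w1 t - (w t \<bullet> w t) * (y1 t / y t)" for t
  define N where "N t = (w t \<bullet> w t) / (y t)^2" for t
  have ww: "((\<lambda>t. w t \<bullet> w t) has_real_derivative 2 * (w t \<bullet> w1 t)) (at t)"
    if "t \<in> {a..b}" for t
    using bounded_bilinear.has_vector_derivative[OF bounded_bilinear_inner dw[OF that] dw[OF that]]
    by (simp add: has_real_derivative_iff_has_vector_derivative inner_commute)
  have ww1: "((\<lambda>t. w t \<bullet> w1 t) has_real_derivative
      (w t \<bullet> (- q t * w t) + w1 t \<bullet> w1 t)) (at t)" if "t \<in> {a..b}" for t
    using bounded_bilinear.has_vector_derivative[OF bounded_bilinear_inner dw[OF that] dw1[OF that]]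
    by (simp add: has_real_derivative_iff_has_vector_derivative)
  have \<Phi>_mono: "\<exists>d. (\<Phi> has_real_derivative d) (at t) \<and> 0 \<le> d" if "t \<in> {a..b}" for t
  proof (intro exI conjI)
    define u where "u = y1 t / y t"
    have yt: "y t > 0" using y that by simp
    show "(\<Phi> has_real_derivative (w t \<bullet> (- q t * w t) + w1 t \<bullet> w1 t
        - (2 * (w t \<bullet> w1 t) * u + (w t \<bullet> w t) * (- p t - u^2)))) (at t)"
      unfolding \<Phi>_def[abs_def] u_def
      by (rule derivative_eq_intros ww[OF that] ww1[OF that] dy[OF that] dy1[OF that] refl
           | use yt in \<open>simp add: field_simps power2_eq_square\<close>)+
    have "w t \<bullet> (q t * w t) \<le> cmod (w t) * cmod (q t * w t)"
      by (rule norm_cauchy_schwarz)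
    also have "\<dots> = cmod (q t) * (cmod (w t))^2"
      by (simp add: norm_mult power2_eq_square)
    also have "\<dots> \<le> p t * (cmod (w t))^2"
      by (rule mult_right_mono) (use qp that in auto)
    finally have 1: "w t \<bullet> (q t * w t) \<le> p t * (w t \<bullet> w t)"
      by (simp add: power2_norm_eq_inner)
    have "0 \<le> (w1 t - u *\<^sub>R w t) \<bullet> (w1 t - u *\<^sub>R w t)" by simp
    also have "\<dots> = w1 t \<bullet> w1 t - 2 * (w t \<bullet> w1 t) * u + u^2 * (w t \<bullet> w t)"
      by (simp add: inner_diff_left inner_diff_right inner_commute power2_eq_square)
    finally show "0 \<le> w t \<bullet> (- q t * w t) + w1 t \<bullet> w1 t
        - (2 * (w t \<bullet> w1 t) * u + (w t \<bullet> w t) * (- p t - u^2))"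
      using 1 by (simp add: algebra_simps)
  qed
  have \<Phi>0: "\<Phi> t = 0" if t: "t \<in> {a..b}" for t
  proof (rule antisym)
    have "\<Phi> t \<le> \<Phi> b"
      by (rule DERIV_nonneg_imp_nondecreasing) (use t \<Phi>_mono in auto)
    then show "\<Phi> t \<le> 0" by (simp add: \<Phi>_def zeros)
    have "\<Phi> a \<le> \<Phi> t"
      by (rule DERIV_nonneg_imp_nondecreasing) (use t \<Phi>_mono in auto)
    then show "0 \<le> \<Phi> t" by (simp add: \<Phi>_def zeros)
  qed
  have dN: "(N has_real_derivative 0) (at t)" if t: "t \<in> {a..b}" for t
  proof -
    have yt: "y t > 0" using y that by simp
    have "(N has_real_derivative 2 * \<Phi> t / (y t)^2) (at t)"
      unfolding N_def[abs_def] \<Phi>_def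
      by (rule derivative_eq_intros ww[OF that] dy[OF that] refl
           | use yt in \<open>simp add: field_simps power2_eq_square\<close>)+
    then show ?thesis using \<Phi>0[OF t] by simp
  qed
  have "continuous_on {a..b} N"
    by (intro continuous_at_imp_continuous_on ballI DERIV_isCont[OF dN])
  then have "N x = N a"
    by (rule DERIV_isconst2[OF ab]) (use dN x in auto)
  then show ?thesis using y[OF x] by (simp add: N_def zeros)
qed

text \<open>Suppose that \<open>v\<close> stays positive. Then \<open>W = y\<^sup>2 (v / y)'\<close> is nonincreasing, because
\<open>W' = (p - Q) y v \<le> 0\<close>, and it becomes negative immediately after \<open>x0\<close>. Hence
\<open>(v / y)' \<le> - const / y\<^sup>2 \<le> - const / (b - x)\<^sup>2\<close>, which is not integrable at \<open>b\<close> and drives \<open>v / y\<close> below \<open>0\<close>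
before \<open>b\<close>.\<close>

lemma zero_to_the_right:
  fixes v v1 y y1 p Q :: "real \<Rightarrow> real"
  assumes x0: "x0 < b"
    and dv: "\<And>x. x \<in> {x0..<b} \<Longrightarrow> (v has_real_derivative v1 x) (at x)"
    and dv1: "\<And>x. x \<in> {x0..<b} \<Longrightarrow> (v1 has_real_derivative - Q x * v x) (at x)"
    and dy: "\<And>x. x \<in> {x0..<b} \<Longrightarrow> (y has_real_derivative y1 x) (at x)"
    and dy1: "\<And>x. x \<in> {x0..<b} \<Longrightarrow> (y1 has_real_derivative - p x * y x) (at x)"
    and y: "\<And>x. x \<in> {x0..<b} \<Longrightarrow> y x > 0"
    and pQ: "\<And>x. x \<in> {x0..<b} \<Longrightarrow> p x \<le> Q x"
    and strict: "p x0 < Q x0"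
    and init: "v x0 = y x0" "v1 x0 = y1 x0"
    and lin: "\<And>x. x \<in> {x0..<b} \<Longrightarrow> y x \<le> C * (b - x)"
  shows "\<exists>z. x0 < z \<and> z < b \<and> v z = 0"
proof (rule ccontr)
  assume contra: "\<not> ?thesis"
  have y0: "y x0 > 0" using y x0 by simp
  have vpos: "v x > 0" if x: "x \<in> {x0..<b}" for x
  proof (rule ccontr)
    assume "\<not> v x > 0"
    then have "\<exists>z\<ge>x0. z \<le> x \<and> v z = 0"
      by (intro IVT2) (use x y0 init in \<open>auto intro!: DERIV_isCont[OF dv]\<close>)
    then obtain z where z: "x0 \<le> z" "z \<le> x" "v z = 0" by blast
    then show False using contra x y0 init by (cases "z = x0") auto
  qed
  define W where "W t = y t * v1 t - v t * y1 t" for t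
  have dW: "(W has_real_derivative (p t - Q t) * (y t * v t)) (at t)" if "t \<in> {x0..<b}" for t
    unfolding W_def[abs_def]
    by (rule derivative_eq_intros dv[OF that] dv1[OF that] dy[OF that] dy1[OF that] refl
         | simp add: algebra_simps)+
  have W0: "W x0 = 0" by (simp add: W_def init)
  have "(p x0 - Q x0) * (y x0 * v x0) < 0"
    using strict y0 init by (simp add: mult_neg_pos)
  then obtain d where d: "d > 0" "\<And>h. 0 < h \<Longrightarrow> h < d \<Longrightarrow> W (x0 + h) < W x0"
    using DERIV_neg_dec_right[OF dW[of x0]] x0 by auto
  define x1 where "x1 = x0 + min (d/2) ((b - x0)/2)"
  have "W x1 < W x0" unfolding x1_def using d x0 by (intro d(2)) auto
  moreover have x1: "x0 < x1" "x1 < b" unfolding x1_def using d x0 by (auto simp: min_def field_simps)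
  ultimately have W1: "W x1 < 0" using W0 by simp
  have Wle: "W x \<le> W x1" if "x1 \<le> x" "x < b" for x
  proof (rule DERIV_nonpos_imp_nonincreasing[OF that(1)])
    fix t assume t: "x1 \<le> t" "t \<le> x"
    then have t': "t \<in> {x0..<b}" using x1 that by auto
    have "(p t - Q t) * (y t * v t) \<le> 0"
      using pQ[OF t'] y[OF t'] vpos[OF t'] by (intro mult_nonpos_nonneg) auto
    then show "\<exists>y. (W has_real_derivative y) (at t) \<and> y \<le> 0" using dW[OF t'] by blast
  qed
  have "0 < C * (b - x0)" using lin[of x0] y0 x0 by auto
  then have C: "C > 0" using x0 by (simp add: zero_less_mult_iff)
  define c where "c = - W x1 / C^2"
  have c: "c > 0" unfolding c_def using W1 C by (simp add: divide_neg_pos)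
  define H where "H t = v t / y t + c / (b - t)" for t
  have H: "H x \<le> H x1" if "x1 \<le> x" "x < b" for x
  proof (rule DERIV_nonpos_imp_nonincreasing[OF that(1)])
    fix t assume t: "x1 \<le> t" "t \<le> x"
    then have t': "t \<in> {x0..<b}" and tb: "b - t > 0" using x1 that by auto
    have yt: "y t > 0" using y t' by simp
    have "(H has_real_derivative W t / (y t)^2 + c / (b - t)^2) (at t)"
      unfolding H_def[abs_def] W_def
      by (rule derivative_eq_intros dv[OF t'] dy[OF t'] refl
           | use yt tb in \<open>simp add: field_simps power2_eq_square\<close>)+
    moreover have "W t / (y t)^2 + c / (b - t)^2 \<le> 0"
    proof -
      have "(y t)^2 \<le> (C * (b - t))^2"
        by (rule power_mono) (use lin[OF t'] yt in auto)
      then have "- W x1 / (C * (b - t))^2 \<le> - W x1 / (y t)^2"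
        using W1 yt by (intro divide_left_mono) (use C tb in auto)
      also have "\<dots> \<le> - W t / (y t)^2"
        using Wle[of t] t that by (intro divide_right_mono) auto
      finally show ?thesis unfolding c_def by (simp add: power_mult_distrib)
    qed
    ultimately show "\<exists>y. (H has_real_derivative y) (at t) \<and> y \<le> 0" by blast
  qed
  have bound: "c \<le> H x1 * (b - x)" if "x1 \<le> x" "x < b" for x
  proof -
    have "v x / y x > 0" using vpos[of x] y[of x] that x1 by auto
    then have "c / (b - x) \<le> H x1" using H[OF that] by (simp add: H_def)
    then show ?thesis using that by (simp add: field_simps)
  qed
  have "0 < H x1 * (b - x1)" using bound[of x1] c x1 by auto
  then have K: "H x1 > 0" using x1 by (simp add: zero_less_mult_iff)
  \<comment> \<open>Any point closer to \<open>b\<close> than \<open>c / H x1\<close> contradicts the last bound.\<close>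
  define x where "x = max x1 (b - c / (2 * H x1))"
  have "x1 \<le> x" "x < b" unfolding x_def using c K x1 by auto
  then have "c \<le> H x1 * (b - x)" by (rule bound)
  also have "\<dots> \<le> H x1 * (c / (2 * H x1))"
    by (rule mult_left_mono) (use K in \<open>auto simp: x_def\<close>)
  also have "\<dots> = c / 2" using K by simp
  finally show False using c by simp
qed

section \<open>The linear equation attached to the Schwarzian\<close>

lemma locally_univalent_deriv_nonzero:
  assumes "f analytic_on S" "open S" "locally_univalent_on f S" "z \<in> S"
  shows "deriv f z \<noteq> 0"
proof -
  obtain U where U: "open U" "z \<in> U" "inj_on f (U \<inter> S)"
    using assms(3,4) unfolding locally_univalent_on_def by blast
  have "f holomorphic_on U \<inter> S"
    using assms(1) analytic_imp_holomorphic holomorphic_on_subset by blast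
  then show ?thesis
    by (rule holomorphic_injective_imp_regular[of f "U \<inter> S"]) (use U assms in auto)
qed

text \<open>From \<open>f' = 1 / s\<^sup>2\<close> one gets \<open>f'' / f' = - 2 s' / s\<close>; in the Schwarzian the squares of \<open>s' / s\<close> then cancel and
\<open>- 2 s'' / s\<close> remains.\<close>

lemma schwarzian_square_root:
  assumes f: "f holomorphic_on S" and S: "open S" "contractible S"
    and nz: "\<And>z. z \<in> S \<Longrightarrow> deriv f z \<noteq> 0"
  obtains s s1 where
    "\<And>z. z \<in> S \<Longrightarrow> s z \<noteq> 0"
    "\<And>z. z \<in> S \<Longrightarrow> deriv f z = 1 / (s z)^2"
    "\<And>z. z \<in> S \<Longrightarrow> (s has_field_derivative s1 z) (at z)"
    "\<And>z. z \<in> S \<Longrightarrow> (s1 has_field_derivative - (schwarzian f z / 2) * s z) (at z)"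
proof -
  have "(\<lambda>z. 1 / deriv f z) holomorphic_on S"
    using f S nz by (intro holomorphic_intros) auto
  then obtain s where s: "s holomorphic_on S" "\<And>z. z \<in> S \<Longrightarrow> 1 / deriv f z = s z ^ 2"
    using contractible_imp_holomorphic_sqrt[of "\<lambda>z. 1 / deriv f z" S] S nz by auto
  have snz: "s z \<noteq> 0" if "z \<in> S" for z
    using s(2)[OF that] nz[OF that] by auto
  have df: "deriv f z = 1 / (s z)^2" if "z \<in> S" for z
    using s(2)[OF that] nz[OF that] snz[OF that] by (simp add: field_simps)
  have ds: "(s has_field_derivative deriv s z) (at z)" if "z \<in> S" for z
    using s(1) S that holomorphic_derivI by blast
  have s1: "deriv s holomorphic_on S" using s(1) S(1) by (rule holomorphic_deriv)
  have ds1: "(deriv s has_field_derivative deriv (deriv s) z) (at z)" if "z \<in> S" for z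
    using s1 S that holomorphic_derivI by blast
  have ddf: "deriv (deriv f) z = - 2 * deriv s z / (s z)^3" if z: "z \<in> S" for z
  proof (rule DERIV_imp_deriv, rule has_field_derivative_transform_within_open)
    show "((\<lambda>z. 1 / (s z)^2) has_field_derivative - 2 * deriv s z / (s z)^3) (at z)"
      by (rule derivative_eq_intros ds[OF z] refl
          | use snz[OF z] in \<open>simp add: field_simps power2_eq_square power3_eq_cube\<close>)+
  qed (use S z df in auto)
  have ratio: "deriv (deriv f) z / deriv f z = - 2 * deriv s z / s z" if z: "z \<in> S" for z
    unfolding ddf[OF z] df[OF z] using snz[OF z]
    by (simp add: field_simps power2_eq_square power3_eq_cube)
  have dratio: "deriv (\<lambda>w. deriv (deriv f) w / deriv f w) z =
      - 2 * (deriv (deriv s) z * s z - (deriv s z)^2) / (s z)^2" if z: "z \<in> S" for z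
  proof (rule DERIV_imp_deriv, rule has_field_derivative_transform_within_open)
    show "((\<lambda>z. - 2 * deriv s z / s z) has_field_derivative
        - 2 * (deriv (deriv s) z * s z - (deriv s z)^2) / (s z)^2) (at z)"
      by (rule derivative_eq_intros ds[OF z] ds1[OF z] refl
          | use snz[OF z] in \<open>simp add: field_simps power2_eq_square\<close>)+
  qed (use S z ratio in auto)
  have "deriv (deriv s) z = - (schwarzian f z / 2) * s z" if z: "z \<in> S" for z
    unfolding schwarzian_def dratio[OF z] ratio[OF z] using snz[OF z]
    by (simp add: field_simps power2_eq_square)
  with snz df ds ds1 that[of s "deriv s"] show thesis by simp
qed

text \<open>The functions \<open>s\<close> and \<open>f s\<close> solve the same linear equation, and their Wronskian \<open>s (f s)' - s' (f s)\<close> is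
\<open>s\<^sup>2 f' = 1\<close>, so every solution is of the form \<open>(A f + B) s\<close>.\<close>

lemma schwarzian_linear_solution:
  assumes f: "f holomorphic_on S" "open S" "z \<in> S"
    and s: "s z \<noteq> 0" "deriv f z = 1 / (s z)^2"
      "(s has_field_derivative s1 z) (at z)"
      "(s1 has_field_derivative - (schwarzian f z / 2) * s z) (at z)"
  shows "((\<lambda>z. (A * f z + B) * s z) has_field_derivative
            A / s z + (A * f z + B) * s1 z) (at z)"
    and "((\<lambda>z. A / s z + (A * f z + B) * s1 z) has_field_derivative
            - (schwarzian f z / 2) * ((A * f z + B) * s z)) (at z)"
proof -
  have df: "(f has_field_derivative 1 / (s z)^2) (at z)"
    using holomorphic_derivI[OF f(1,2,3)] s(2) by simp
  show "((\<lambda>z. (A * f z + B) * s z) has_field_derivative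
            A / s z + (A * f z + B) * s1 z) (at z)"
    by (rule derivative_eq_intros df s(3) refl
        | use s(1) in \<open>simp add: field_simps power2_eq_square\<close>)+
  show "((\<lambda>z. A / s z + (A * f z + B) * s1 z) has_field_derivative
            - (schwarzian f z / 2) * ((A * f z + B) * s z)) (at z)"
    by (rule derivative_eq_intros df s(3,4) refl
        | use s(1) in \<open>simp add: field_simps power2_eq_square\<close>)+
qed

section \<open>Hyperbolic geodesics\<close>

text \<open>For \<open>|\<eta>| = 1\<close> and \<open>|\<rho>| < 1\<close> this is a disc automorphism; the purely imaginary shift \<open>\<i> \<rho>\<close> makes \<open>\<eta> \<i> \<rho>\<close>, the
image of \<open>0\<close>, the point closest to the origin on the image of the real diameter.\<close>

definition geodesic :: "complex \<Rightarrow> real \<Rightarrow> complex \<Rightarrow> complex" where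
  "geodesic \<eta> \<rho> z = \<eta> * (z + \<i> * \<rho>) / (1 - \<i> * \<rho> * z)"

lemma geodesic_denom:
  fixes x :: real
  shows "1 - \<i> * of_real \<rho> * of_real x \<noteq> 0"
proof
  assume "1 - \<i> * of_real \<rho> * of_real x = 0"
  then have "Re (1 - \<i> * of_real \<rho> * of_real x) = 0" by simp
  then show False by simp
qed

lemma geodesic_denom_cmod:
  fixes x :: real
  shows "(cmod (1 - \<i> * of_real \<rho> * of_real x))^2 = 1 + \<rho>^2 * x^2"
  by (simp add: cmod_power2 power_mult_distrib)

lemma cmod_geodesic:
  fixes x :: real
  assumes "cmod \<eta> = 1"
  shows "(cmod (geodesic \<eta> \<rho> x))^2 = (x^2 + \<rho>^2) / (1 + \<rho>^2 * x^2)"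
proof -
  have "(cmod (of_real x + \<i> * of_real \<rho>))^2 = x^2 + \<rho>^2"
    by (simp add: cmod_power2)
  then show ?thesis
    unfolding geodesic_def
    by (simp add: norm_mult norm_divide assms power_divide geodesic_denom_cmod)
qed

text \<open>The left-hand side of the third claim is the modulus of the derivative of \<open>geodesic\<close> at \<open>x\<close>, so that
claim says that the map is a hyperbolic isometry.\<close>

lemma geodesic_conformal:
  fixes x :: real
  assumes "cmod \<eta> = 1" "\<bar>\<rho>\<bar> < 1" "\<bar>x\<bar> < 1"
  shows "\<bar>x\<bar> \<le> cmod (geodesic \<eta> \<rho> x)"
    and "cmod (geodesic \<eta> \<rho> x) < 1"
    and "(1 - \<rho>^2) / (1 + \<rho>^2 * x^2) = (1 - (cmod (geodesic \<eta> \<rho> x))^2) / (1 - x^2)"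
proof -
  have pos: "1 + \<rho>^2 * x^2 > 0" by (rule add_pos_nonneg) auto
  have r: "\<rho>^2 < 1" and x: "x^2 < 1" using assms by (auto simp: abs_square_less_1)
  have eq: "1 - (cmod (geodesic \<eta> \<rho> x))^2 = (1 - \<rho>^2) * (1 - x^2) / (1 + \<rho>^2 * x^2)"
    unfolding cmod_geodesic[OF assms(1)] using pos by (simp add: field_simps)
  show "(1 - \<rho>^2) / (1 + \<rho>^2 * x^2) = (1 - (cmod (geodesic \<eta> \<rho> x))^2) / (1 - x^2)"
    unfolding eq using x by simp
  have "0 < (1 - \<rho>^2) * (1 - x^2) / (1 + \<rho>^2 * x^2)" using r x pos by simp
  then have "(cmod (geodesic \<eta> \<rho> x))^2 < 1" using eq by simp
  then show "cmod (geodesic \<eta> \<rho> x) < 1" by (simp add: abs_square_less_1)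
  have "x^2 * (\<rho>^2 * x^2) \<le> \<rho>^2"
  proof -
    have "x^2 * x^2 \<le> 1" by (rule mult_le_one) (use x in auto)
    then have "\<rho>^2 * (x^2 * x^2) \<le> \<rho>^2" by (simp add: mult_left_le)
    then show ?thesis by (simp add: mult.left_commute)
  qed
  then have "x^2 \<le> (cmod (geodesic \<eta> \<rho> x))^2"
    unfolding cmod_geodesic[OF assms(1)] using pos by (simp add: field_simps)
  then show "\<bar>x\<bar> \<le> cmod (geodesic \<eta> \<rho> x)"
    by (metis abs_le_square_iff abs_norm_cancel)
qed

text \<open>A disc automorphism takes the diameter to a geodesic through \<open>a\<close> and \<open>b\<close>, with \<open>0\<close> going to \<open>a\<close>; it has
the form \<open>e (x + d) / (1 + cnj d x)\<close>. Precomposing it with a real translation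
\<open>x \<mapsto> (x + t) / (1 + t x)\<close> replaces \<open>d\<close> by \<open>(t + d) / (1 + t d)\<close>, up to a rotation, and by the
intermediate value theorem some \<open>t\<close> in \<open>(-1, 1)\<close> makes this purely imaginary.\<close>

lemma geodesic_through_two_points:
  assumes a: "cmod a < 1" and b: "cmod b < 1"
  obtains \<eta> and \<rho> x y :: real where "cmod \<eta> = 1" "\<bar>\<rho>\<bar> < 1" "\<bar>x\<bar> < 1" "\<bar>y\<bar> < 1"
    "geodesic \<eta> \<rho> x = a" "geodesic \<eta> \<rho> y = b"
proof -
  have "cmod (cnj a * b) < 1"
    using a b by (simp add: norm_mult) (metis mult_strict_mono' norm_ge_zero mult_1)
  then have n1: "1 - cnj a * b \<noteq> 0" by auto
  define c where "c = (b - a) / (1 - cnj a * b)"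
  define e where "e = (if c = 0 then 1 else c / cmod c)"
  define r where "r = cmod c"
  define d where "d = a * cnj e"
  have ce: "c = e * r" by (simp add: e_def r_def)
  have e: "cmod e = 1" by (simp add: e_def norm_divide)
  then have ee: "e * cnj e = 1" by (simp add: complex_norm_square[symmetric])
  have "cmod c < 1"
  proof -
    have "cmod (Moebius_function 0 a b) < 1"
      using a b by (rule Moebius_function_norm_lt_1)
    then show ?thesis by (simp add: Moebius_function_def c_def)
  qed
  then have r: "0 \<le> r" "r < 1" by (simp_all add: r_def)
  have d: "cmod d < 1" using a e by (simp add: d_def norm_mult)
  have ed: "e * d = a" using ee by (simp add: d_def mult.left_commute)
  have cd: "cnj d = cnj a * e" by (simp add: d_def)
  \<comment> \<open>The expression is the real part of \<open>(t + d) (1 + t cnj d)\<close>, whose vanishing makes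
     \<open>(t + d) / (1 + t d)\<close> imaginary.\<close>
  have "\<exists>t\<ge>-1. t \<le> 1 \<and> Re d * (1 + t^2) + t * (1 + (cmod d)^2) = 0"
  proof (rule IVT)
    have sq: "2 * cmod d \<le> 1 + (cmod d)^2"
      using zero_le_power2[of "cmod d - 1"] by (simp add: power2_eq_square algebra_simps)
    show "Re d * (1 + (-1)^2) + (-1) * (1 + (cmod d)^2) \<le> 0"
      using sq complex_Re_le_cmod[of d] by simp
    show "0 \<le> Re d * (1 + 1^2) + 1 * (1 + (cmod d)^2)"
      using sq abs_Re_le_cmod[of d] by simp
  qed (auto intro!: continuous_intros)
  then obtain t where t: "-1 \<le> t" "t \<le> 1"
    "Re d * (1 + t^2) + t * (1 + (cmod d)^2) = 0" by blast
  have sq: "2 * cmod d < 1 + (cmod d)^2"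
  proof -
    have "0 < (1 - cmod d)^2" using d by simp
    then show ?thesis by (simp add: power2_eq_square algebra_simps)
  qed
  have "t \<noteq> 1" "t \<noteq> -1" using t(3) sq abs_Re_le_cmod[of d] by auto
  then have t1: "\<bar>t\<bar> < 1" using t by auto
  have td: "cmod (of_real t * d) < 1"
    using t1 d by (simp add: norm_mult) (metis mult_strict_mono' norm_ge_zero mult_1 abs_ge_zero)
  have nz: "1 + of_real t * d \<noteq> 0"
    using td by (metis add.commute add_eq_0_iff norm_minus_cancel norm_one order_less_irrefl)
  then have nz': "1 + of_real t * cnj d \<noteq> 0"
    by (metis complex_cnj_add complex_cnj_complex_of_real complex_cnj_mult complex_cnj_one
        complex_cnj_zero_iff)
  define \<delta> where "\<delta> = (of_real t + d) / (1 + of_real t * d)"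
  define \<rho> where "\<rho> = Im \<delta>"
  define \<eta> where "\<eta> = e * (1 + of_real t * d) / (1 + of_real t * cnj d)"
  have "Re ((of_real t + d) * cnj (1 + of_real t * d)) =
      Re d * (1 + t^2) + t * (1 + (cmod d)^2)"
    unfolding cmod_power2 by (simp add: algebra_simps power2_eq_square)
  then have "Re \<delta> = 0"
    unfolding \<delta>_def using t(3) by (simp add: Re_complex_div_eq_0)
  then have \<delta>: "\<delta> = \<i> * \<rho>" by (simp add: \<rho>_def complex_eq_iff)
  then have c\<delta>: "cnj \<delta> = - (\<i> * \<rho>)" by simp
  have "cmod \<delta> < 1"
  proof -
    have "cmod (Moebius_function 0 (- of_real t) d) < 1"
      using t1 d by (intro Moebius_function_norm_lt_1) auto
    then show ?thesis by (simp add: Moebius_function_def \<delta>_def add.commute)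
  qed
  then have \<rho>: "\<bar>\<rho>\<bar> < 1" using abs_Im_le_cmod[of \<delta>] by (simp add: \<rho>_def)
  have "cmod (1 + of_real t * cnj d) = cmod (1 + of_real t * d)"
    by (metis complex_cnj_add complex_cnj_complex_of_real complex_cnj_mult complex_cnj_one
        complex_mod_cnj)
  then have \<eta>: "cmod \<eta> = 1" using e nz by (simp add: \<eta>_def norm_mult norm_divide)
  have reparam: "geodesic \<eta> \<rho> (of_real ((x - t) / (1 - t * x))) =
      (e * x + a) / (1 + cnj a * (e * x))" if x: "\<bar>x\<bar> < 1" for x :: real
  proof -
    have "\<bar>t * x\<bar> < 1" using t1 x by (simp add: abs_mult) (metis mult_strict_mono' abs_ge_zero mult_1)
    then have tx: "1 - t * x \<noteq> 0" by auto
    then have tx': "1 - of_real t * of_real x \<noteq> (0::complex)"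
      by (metis of_real_1 of_real_diff of_real_eq_0_iff of_real_mult)
    have tt: "1 - t^2 \<noteq> 0" using t1 by (simp add: abs_square_eq_1)
    then have tt': "1 - (of_real t)^2 \<noteq> (0::complex)"
      by (metis of_real_1 of_real_diff of_real_eq_0_iff of_real_power)
    have "cmod (cnj d * of_real x) < 1"
      using d x by (simp add: norm_mult) (metis mult_strict_mono' norm_ge_zero mult_1 abs_ge_zero)
    then have dx: "1 + cnj d * of_real x \<noteq> 0"
      by (metis add.commute add_eq_0_iff norm_minus_cancel norm_one order_less_irrefl)
    define X :: complex where "X = (of_real x - of_real t) / (1 - of_real t * of_real x)"
    have num: "X + \<delta> = (1 - (of_real t)^2) * (of_real x + d)
        / ((1 - of_real t * of_real x) * (1 + of_real t * d))"
      unfolding X_def \<delta>_def using tx' nz by (simp add: divide_simps) algebra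
    have den: "1 + cnj \<delta> * X = (1 - (of_real t)^2) * (1 + cnj d * of_real x)
        / ((1 - of_real t * of_real x) * (1 + of_real t * cnj d))"
      unfolding X_def \<delta>_def using tx' nz' by (simp add: divide_simps) algebra
    have "geodesic \<eta> \<rho> (of_real ((x - t) / (1 - t * x))) = \<eta> * (X + \<delta>) / (1 + cnj \<delta> * X)"
      unfolding geodesic_def X_def by (simp add: \<delta>)
    also have "\<dots> = e * (of_real x + d) / (1 + cnj d * of_real x)"
      unfolding num den \<eta>_def using tx' tt' nz nz' dx by (simp add: divide_simps)
    also have "\<dots> = (e * x + a) / (1 + cnj a * (e * x))"
      using ed cd by (simp add: algebra_simps)
    finally show ?thesis .
  qed
  have range: "\<bar>(x - t) / (1 - t * x)\<bar> < 1" if x: "\<bar>x\<bar> < 1" for x :: real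
  proof -
    have "0 < (1 - t) * (1 + x)" "0 < (1 + t) * (1 - x)" using t1 x by auto
    moreover from this have "1 - t * x > 0" by (simp add: algebra_simps)
    ultimately show ?thesis by (simp add: abs_less_iff field_simps)
  qed
  show thesis
  proof (rule that[OF \<eta> \<rho>])
    show "\<bar>(0 - t) / (1 - t * 0)\<bar> < 1" "\<bar>(r - t) / (1 - t * r)\<bar> < 1"
      using range[of 0] range[of r] r by auto
    show "geodesic \<eta> \<rho> (of_real ((0 - t) / (1 - t * 0))) = a"
      by (subst reparam) auto
    have "1 + cnj a * c = (1 - a * cnj a) / (1 - cnj a * b)"
      unfolding c_def using n1 by (simp add: field_simps)
    moreover have "c + a = b * (1 - a * cnj a) / (1 - cnj a * b)"
      unfolding c_def using n1 by (simp add: field_simps)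
    moreover have "1 - a * cnj a \<noteq> 0"
    proof -
      have "(cmod a)^2 < 1" using a by (simp add: abs_square_less_1)
      then show ?thesis
        by (metis complex_norm_square eq_iff_diff_eq_0 of_real_eq_1_iff order_less_irrefl)
    qed
    ultimately have "(c + a) / (1 + cnj a * c) = b" using n1 by simp
    then show "geodesic \<eta> \<rho> (of_real ((r - t) / (1 - t * r))) = b"
      using r by (subst reparam) (auto simp: ce)
  qed
qed

text \<open>This is the transformation law of the equation \<open>w'' + q w = 0\<close> under a Moebius map \<open>\<gamma>\<close>. Here
\<open>\<gamma>' = \<kappa> / \<tau>\<^sup>2\<close>, so \<open>\<tau>\<close> is the weight \<open>\<gamma>'\<close> to the power \<open>- 1 / 2\<close> up to a constant. As \<open>\<tau>\<close> is affine, no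
Schwarzian of \<open>\<gamma>\<close> enters the new coefficient \<open>q (\<gamma>')\<^sup>2\<close>.\<close>

lemma solution_along_geodesic:
  fixes x \<rho> :: real and \<eta> q z \<kappa> :: complex and w w1 \<tau> :: "complex \<Rightarrow> complex"
  defines "z \<equiv> geodesic \<eta> \<rho> x" and "\<tau> \<equiv> \<lambda>x::complex. 1 - \<i> * of_real \<rho> * x"
    and "\<kappa> \<equiv> \<eta> * of_real (1 - \<rho>^2)"
  assumes w: "(w has_field_derivative w1 z) (at z)"
    and w1: "(w1 has_field_derivative - q * w z) (at z)"
  shows "((\<lambda>x. \<tau> (of_real x) * w (geodesic \<eta> \<rho> x)) has_vector_derivative
      - \<i> * \<rho> * w z + \<kappa> * w1 z / \<tau> x) (at x)"
    and "((\<lambda>x. - \<i> * \<rho> * w (geodesic \<eta> \<rho> x) + \<kappa> * w1 (geodesic \<eta> \<rho> x) / \<tau> (of_real x))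
      has_vector_derivative - (q * (\<kappa> / (\<tau> x)^2)^2) * (\<tau> x * w z)) (at x)"
proof -
  have nz: "\<tau> x \<noteq> 0" unfolding \<tau>_def by (rule geodesic_denom)
  have d\<tau>: "(\<tau> has_field_derivative - \<i> * \<rho>) (at x)"
    unfolding \<tau>_def by (auto intro!: derivative_eq_intros)
  have g: "(geodesic \<eta> \<rho> has_field_derivative \<kappa> / (\<tau> x)^2) (at (of_real x))"
    unfolding geodesic_def[abs_def] \<kappa>_def \<tau>_def
    by (rule derivative_eq_intros refl geodesic_denom)+
       (simp add: power2_eq_square algebra_simps)
  note W = DERIV_chain2[OF w[unfolded z_def] g] and W1 = DERIV_chain2[OF w1[unfolded z_def] g]
  have 1: "((\<lambda>x. \<tau> x * w (geodesic \<eta> \<rho> x)) has_field_derivative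
      - \<i> * \<rho> * w z + \<kappa> * w1 z / \<tau> x) (at (of_real x))"
    by (rule derivative_eq_intros d\<tau> W refl
        | use nz in \<open>simp add: z_def field_simps power2_eq_square\<close>)+
  have 2: "((\<lambda>x. - \<i> * \<rho> * w (geodesic \<eta> \<rho> x) + \<kappa> * w1 (geodesic \<eta> \<rho> x) / \<tau> x)
      has_field_derivative - (q * (\<kappa> / (\<tau> x)^2)^2) * (\<tau> x * w z)) (at (of_real x))"
    by (rule derivative_eq_intros d\<tau> W W1 nz refl
        | use nz in \<open>simp add: z_def field_simps power2_eq_square\<close>)+
  show "((\<lambda>x. \<tau> (of_real x) * w (geodesic \<eta> \<rho> x)) has_vector_derivative
      - \<i> * \<rho> * w z + \<kappa> * w1 z / \<tau> x) (at x)"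
    using has_vector_derivative_real_field[OF 1] .
  show "((\<lambda>x. - \<i> * \<rho> * w (geodesic \<eta> \<rho> x) + \<kappa> * w1 (geodesic \<eta> \<rho> x) / \<tau> (of_real x))
      has_vector_derivative - (q * (\<kappa> / (\<tau> x)^2)^2) * (\<tau> x * w z)) (at x)"
    using has_vector_derivative_real_field[OF 2] .
qed

section \<open>The univalence criterion and its sharpness\<close>

lemma cmod_geodesic_slope:
  fixes x :: real
  assumes "cmod \<eta> = 1" "\<bar>\<rho>\<bar> < 1"
  shows "cmod (\<eta> * of_real (1 - \<rho>^2) / (1 - \<i> * of_real \<rho> * of_real x)^2)
           = (1 - \<rho>^2) / (1 + \<rho>^2 * x^2)"
proof -
  have "\<rho>^2 \<le> 1" using assms(2) by (simp add: abs_square_le_1)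
  then have "cmod (of_real (1 - \<rho>^2)) = 1 - \<rho>^2" by (simp only: norm_of_real)
  then show ?thesis
    by (simp only: norm_divide norm_mult norm_power geodesic_denom_cmod assms(1) mult_1)
qed

text \<open>If \<open>f a = f b\<close>, then \<open>w = (f - f a) s\<close> is a solution vanishing at \<open>a\<close> and \<open>b\<close> whose slope at \<open>a\<close> is
\<open>1 / s a\<close>. Along the geodesic through \<open>a\<close> and \<open>b\<close> the comparison makes it vanish identically between
these points, against the nonzero slope.\<close>

lemma univalence_criterion:
  fixes lam :: real
  assumes l0: "0 \<le> lam" and l: "lam \<le> (1/8) * ((4 + pi^2) - sqrt (16 + pi^4))"
    and f: "f analytic_on ball 0 1" "locally_univalent_on f (ball 0 1)"
    and Sf: "\<And>z. z \<in> ball 0 1 \<Longrightarrow> cmod (schwarzian f z) \<le> 2 * schwarz_majorant lam (cmod z)"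
  shows "inj_on f (ball 0 1)"
proof (rule inj_onI, rule ccontr)
  fix a b assume a: "a \<in> ball (0::complex) 1" and b: "b \<in> ball (0::complex) 1"
    and fab: "f a = f b" and ab: "a \<noteq> b"
  let ?D = "ball (0::complex) 1"
  have fD: "f holomorphic_on ?D" using f(1) by (rule analytic_imp_holomorphic)
  have nz: "deriv f z \<noteq> 0" if "z \<in> ?D" for z
    using locally_univalent_deriv_nonzero[OF f(1) open_ball f(2) that] .
  obtain s s1 where s:
    "\<And>z. z \<in> ?D \<Longrightarrow> s z \<noteq> 0"
    "\<And>z. z \<in> ?D \<Longrightarrow> deriv f z = 1 / (s z)^2"
    "\<And>z. z \<in> ?D \<Longrightarrow> (s has_field_derivative s1 z) (at z)"
    "\<And>z. z \<in> ?D \<Longrightarrow> (s1 has_field_derivative - (schwarzian f z / 2) * s z) (at z)"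
    using schwarzian_square_root[OF fD open_ball convex_imp_contractible[OF convex_ball] nz]
    by blast
  define w where "w z = (1 * f z + (- f a)) * s z" for z
  define w1 where "w1 z = 1 / s z + (1 * f z + (- f a)) * s1 z" for z
  have w: "(w has_field_derivative w1 z) (at z)"
    "(w1 has_field_derivative - (schwarzian f z / 2) * w z) (at z)" if "z \<in> ?D" for z
    using schwarzian_linear_solution[OF fD open_ball that s(1)[OF that] s(2)[OF that]
        s(3)[OF that] s(4)[OF that], of 1 "- f a"]
    unfolding w_def[abs_def] w1_def[abs_def] by auto
  obtain \<eta> and \<rho> x y :: real where g: "cmod \<eta> = 1" "\<bar>\<rho>\<bar> < 1" "\<bar>x\<bar> < 1" "\<bar>y\<bar> < 1"
    "geodesic \<eta> \<rho> x = a" "geodesic \<eta> \<rho> y = b"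
    using geodesic_through_two_points a b unfolding mem_ball_0 by blast
  have "x \<noteq> y" using g ab by auto
  define \<tau> where "\<tau> z = 1 - \<i> * of_real \<rho> * z" for z
  define \<kappa> where "\<kappa> = \<eta> * of_real (1 - \<rho>^2)"
  define W where "W x = \<tau> (of_real x) * w (geodesic \<eta> \<rho> (of_real x))" for x
  define W1 where "W1 x = - \<i> * \<rho> * w (geodesic \<eta> \<rho> (of_real x))
      + \<kappa> * w1 (geodesic \<eta> \<rho> (of_real x)) / \<tau> (of_real x)" for x
  define q where "q x = schwarzian f (geodesic \<eta> \<rho> (of_real x)) / 2 * (\<kappa> / (\<tau> (of_real x))^2)^2"
    for x :: real
  have gD: "geodesic \<eta> \<rho> (of_real t) \<in> ?D" if "\<bar>t\<bar> < 1" for t :: real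
    using geodesic_conformal(2)[OF g(1,2) that] by simp
  have dW: "(W has_vector_derivative W1 t) (at t)"
    "(W1 has_vector_derivative - q t * W t) (at t)" if t: "\<bar>t\<bar> < 1" for t
    using solution_along_geodesic[of w w1 \<eta> \<rho> t, OF w[OF gD[OF t]]]
    unfolding W_def[abs_def] W1_def[abs_def] q_def \<tau>_def \<kappa>_def by auto
  have qp: "cmod (q t) \<le> schwarz_majorant lam t" if t: "\<bar>t\<bar> < 1" for t
  proof -
    let ?z = "geodesic \<eta> \<rho> (of_real t)"
    have z: "\<bar>t\<bar> \<le> cmod ?z" "cmod ?z < 1" using geodesic_conformal[OF g(1,2) t] by auto
    have t2: "(1 - t^2)^2 > 0"
      using t by (simp add: abs_square_eq_1)
    have slope: "cmod (\<kappa> / (\<tau> (of_real t))^2) = (1 - (cmod ?z)^2) / (1 - t^2)"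
      unfolding \<kappa>_def \<tau>_def cmod_geodesic_slope[OF g(1,2)]
      by (rule geodesic_conformal(3)[OF g(1,2) t])
    have "cmod (q t) = cmod (schwarzian f ?z) / 2 * ((1 - (cmod ?z)^2) / (1 - t^2))^2"
      unfolding q_def norm_mult norm_power slope by (simp add: norm_divide)
    also have "\<dots> \<le> schwarz_majorant lam (cmod ?z) * ((1 - (cmod ?z)^2) / (1 - t^2))^2"
      by (rule mult_right_mono) (use Sf[OF gD[OF t]] in auto)
    also have "\<dots> = (1 - (cmod ?z)^2)^2 * schwarz_majorant lam (cmod ?z) / (1 - t^2)^2"
      by (simp add: power_divide)
    also have "\<dots> \<le> (1 - \<bar>t\<bar>^2)^2 * schwarz_majorant lam \<bar>t\<bar> / (1 - t^2)^2"
      by (rule divide_right_mono[OF invariant_majorant_antimono[OF l0 l]]) (use z in auto)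
    also have "\<dots> = schwarz_majorant lam t"
      using t2 schwarz_majorant_even[of lam t] by (auto simp: abs_if)
    finally show ?thesis .
  qed
  define m where "m = min x y"
  define M where "M = max x y"
  have mM: "m < M" "\<bar>m\<bar> < 1" "\<bar>M\<bar> < 1" using \<open>x \<noteq> y\<close> g by (auto simp: m_def M_def min_def max_def)
  have in1: "\<bar>t\<bar> < 1" if "t \<in> {m..M}" for t using that mM by auto
  have Wxy: "W x = 0" "W y = 0" using g fab by (auto simp: W_def w_def)
  have W0: "W t = 0" if "t \<in> {m..M}" for t
  proof (rule no_two_zeros_if_majorized[of m M W W1 q "comparison_solution lam"
        "comparison_slope lam" "schwarz_majorant lam", OF mM(1)])
    show "W m = 0" "W M = 0" using Wxy by (auto simp: m_def M_def min_def max_def)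
  qed (use in1 dW qp that in \<open>auto intro: comparison_solution_pos comparison_solution_deriv
         comparison_slope_deriv[simplified]\<close>)
  have x: "x \<in> {m..M}" by (auto simp: m_def M_def)
  have "(W has_vector_derivative W1 x) (at x within {m..M})"
    using dW(1)[OF g(3)] by (rule has_vector_derivative_at_within)
  moreover have "(W has_vector_derivative 0) (at x within {m..M})"
    by (rule has_vector_derivative_transform[OF x _ has_vector_derivative_const[of 0]])
       (use W0 in auto)
  ultimately have "W1 x = 0"
    using vector_derivative_unique_within_closed_interval[of m M x W] mM(1) x by simp
  moreover have "\<kappa> \<noteq> 0"
    unfolding \<kappa>_def using g(1,2)
    by (auto simp: abs_square_eq_1 simp flip: of_real_power)
  moreover have "\<tau> (of_real x) \<noteq> 0" unfolding \<tau>_def by (rule geodesic_denom)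
  ultimately show False
    using s(1)[OF a] g(5) by (simp add: W1_def w_def w1_def)
qed

text \<open>The imaginary part of \<open>v\<close> solves the equation with zero initial data. Its Wronskians with the
two solutions \<open>s\<close> and \<open>u\<close> are therefore constant and zero, and since these two are independent at every
point, the imaginary part vanishes. This replaces an appeal to uniqueness for initial value problems.\<close>

lemma real_solution_of_real_equation:
  fixes v v1 s s1 u u1 q :: "real \<Rightarrow> complex"
  assumes dv: "\<And>t. t \<in> {a<..<b} \<Longrightarrow> (v has_vector_derivative v1 t) (at t)"
      "\<And>t. t \<in> {a<..<b} \<Longrightarrow> (v1 has_vector_derivative - q t * v t) (at t)"
    and ds: "\<And>t. t \<in> {a<..<b} \<Longrightarrow> (s has_vector_derivative s1 t) (at t)"
      "\<And>t. t \<in> {a<..<b} \<Longrightarrow> (s1 has_vector_derivative - q t * s t) (at t)"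
    and du: "\<And>t. t \<in> {a<..<b} \<Longrightarrow> (u has_vector_derivative u1 t) (at t)"
      "\<And>t. t \<in> {a<..<b} \<Longrightarrow> (u1 has_vector_derivative - q t * u t) (at t)"
    and indep: "\<And>t. t \<in> {a<..<b} \<Longrightarrow> s t * u1 t \<noteq> s1 t * u t"
    and q: "\<And>t. t \<in> {a<..<b} \<Longrightarrow> q t \<in> \<real>"
    and c: "c \<in> {a<..<b}" "v c \<in> \<real>" "v1 c \<in> \<real>"
    and t: "t \<in> {a<..<b}"
  shows "v t \<in> \<real>"
proof -
  define h where "h t = complex_of_real (Im (v t))" for t
  define h1 where "h1 t = complex_of_real (Im (v1 t))" for t
  have im: "bounded_linear (\<lambda>z. complex_of_real (Im z))"
    by (rule bounded_linear_compose[OF bounded_linear_of_real bounded_linear_Im])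
  have dh: "(h has_vector_derivative h1 t) (at t)" if "t \<in> {a<..<b}" for t
    unfolding h_def[abs_def] h1_def
    by (rule bounded_linear.has_vector_derivative[OF im dv(1)[OF that]])
  have dh1: "(h1 has_vector_derivative - q t * h t) (at t)" if "t \<in> {a<..<b}" for t
  proof -
    have "complex_of_real (Im (- q t * v t)) = - q t * h t"
      using q[OF that] by (auto simp: h_def complex_eq_iff complex_is_Real_iff)
    then show ?thesis
      using bounded_linear.has_vector_derivative[OF im dv(2)[OF that]]
      unfolding h1_def[abs_def] by simp
  qed
  have wronskian: "h t * r1 t = h1 t * r t"
    if r: "\<And>t. t \<in> {a<..<b} \<Longrightarrow> (r has_vector_derivative r1 t) (at t)"
      "\<And>t. t \<in> {a<..<b} \<Longrightarrow> (r1 has_vector_derivative - q t * r t) (at t)" for r r1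
  proof -
    have d: "((\<lambda>t. h t * r1 t - h1 t * r t) has_vector_derivative 0) (at x within {a<..<b})"
      if x: "x \<in> {a<..<b}" for x
    proof -
      have "((\<lambda>t. h t * r1 t - h1 t * r t) has_vector_derivative
          (h x * (- q x * r x) + h1 x * r1 x) - (h1 x * r1 x + (- q x * h x) * r x)) (at x)"
        by (intro has_vector_derivative_diff has_vector_derivative_mult dh dh1 r x)
      then show ?thesis by (simp add: algebra_simps has_vector_derivative_at_within)
    qed
    obtain k where k: "\<And>x. x \<in> {a<..<b} \<Longrightarrow> h x * r1 x - h1 x * r x = k"
      using has_vector_derivative_zero_constant[OF convex_real_interval(8) d] by blast
    have "h c = 0" "h1 c = 0" using c by (auto simp: h_def h1_def complex_is_Real_iff)
    then show ?thesis using k[OF c(1)] k[OF t] by simp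
  qed
  have "h t * s1 t = h1 t * s t" "h t * u1 t = h1 t * u t"
    using wronskian[OF ds] wronskian[OF du] by auto
  then have "h t * (s t * u1 t - s1 t * u t) = 0" by algebra
  then have "h t = 0" using indep[OF t] by auto
  then show ?thesis by (simp add: h_def complex_is_Real_iff)
qed

lemma schwarz_majorant_of_real:
  "schwarz_majorant lam (of_real x :: complex) = of_real (schwarz_majorant lam x)"
  unfolding schwarz_majorant_def by (simp add: tan_of_real)

lemma schwarz_majorant_holomorphic:
  "(schwarz_majorant lam :: complex \<Rightarrow> complex) holomorphic_on ball 0 1"
proof -
  have "cos (of_real pi * z / 2) \<noteq> 0" if "z \<in> ball 0 1" for z :: complex
  proof
    assume "cos (of_real pi * z / 2) = 0"
    then obtain n :: int where "of_real pi * z / 2 = complex_of_real (n * pi) + of_real pi / 2"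
      using cos_eq_0 by blast
    then have "of_real pi * z = of_real pi * of_int (2 * n + 1)"
      by (simp add: field_simps)
    then have "z = of_int (2 * n + 1)" by simp
    then have "\<bar>real_of_int (2 * n + 1)\<bar> < 1"
      using that by (metis mem_ball_0 norm_of_int of_int_abs)
    then have "\<bar>2 * n + 1\<bar> < 1" by linarith
    then show False by presburger
  qed
  then show ?thesis
    unfolding schwarz_majorant_def[abs_def] tan_def
    by (intro holomorphic_intros) auto
qed

text \<open>The solution \<open>v = (A f + B) s\<close> that touches the comparison solution at \<open>x\<^sub>0\<close> is real on the diameter, since
its equation and its initial data are. The zero to the left of \<open>x\<^sub>0\<close> comes from
the reflected equation, whose comparison is the same because \<open>p\<close> and the comparison solution are even. At the two zeros of \<open>v\<close> the
function \<open>f\<close> takes the same value \<open>- B / A\<close>.\<close>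

lemma criterion_is_sharp:
  assumes l0: "0 \<le> lam"
  shows "sharp_univalence_criterion lam"
  unfolding sharp_univalence_criterion_def
proof (intro allI impI notI)
  fix f :: "complex \<Rightarrow> complex"
  let ?D = "ball (0::complex) 1"
  assume f: "f analytic_on ?D" "locally_univalent_on f ?D"
    and Sx: "\<forall>x::real. -1 < x \<and> x < 1 \<longrightarrow> schwarzian f (of_real x) \<in> \<real> \<and>
             Re (schwarzian f (of_real x)) \<ge> 2 * schwarz_majorant lam x"
    and ne: "\<exists>z\<in>?D. schwarzian f z \<noteq> 2 * schwarz_majorant lam z"
    and inj: "inj_on f ?D"
  have fD: "f holomorphic_on ?D" using f(1) by (rule analytic_imp_holomorphic)
  have nz: "deriv f z \<noteq> 0" if "z \<in> ?D" for z
    using locally_univalent_deriv_nonzero[OF f(1) open_ball f(2) that] .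
  obtain s s1 where s:
    "\<And>z. z \<in> ?D \<Longrightarrow> s z \<noteq> 0"
    "\<And>z. z \<in> ?D \<Longrightarrow> deriv f z = 1 / (s z)^2"
    "\<And>z. z \<in> ?D \<Longrightarrow> (s has_field_derivative s1 z) (at z)"
    "\<And>z. z \<in> ?D \<Longrightarrow> (s1 has_field_derivative - (schwarzian f z / 2) * s z) (at z)"
    using schwarzian_square_root[OF fD open_ball convex_imp_contractible[OF convex_ball] nz]
    by blast
  have SD: "schwarzian f holomorphic_on ?D"
    unfolding schwarzian_def[abs_def]
    by (intro holomorphic_intros holomorphic_deriv fD) (use nz in auto)
  define Q where "Q x = Re (schwarzian f (of_real x)) / 2" for x
  define p :: "real \<Rightarrow> real" where "p = schwarz_majorant lam"
  have SQ: "schwarzian f (of_real x) / 2 = of_real (Q x)" if "x \<in> {-1<..<1}" for x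
    using Sx that by (auto simp: Q_def complex_is_Real_iff complex_eq_iff)
  have pQ: "p x \<le> Q x" if "x \<in> {-1<..<1}" for x
    using Sx that by (auto simp: Q_def p_def)
  have "\<exists>x0\<in>{-1<..<1}. p x0 < Q x0"
  proof (rule ccontr)
    assume no: "\<not> ?thesis"
    have eq: "schwarzian f z - 2 * schwarz_majorant lam z = 0" if "z \<in> ?D" for z
    proof (rule analytic_continuation[of "\<lambda>z. schwarzian f z - 2 * schwarz_majorant lam z" ?D
          "of_real ` {-1<..<1}" 0])
      show "(\<lambda>z. schwarzian f z - 2 * schwarz_majorant lam z) holomorphic_on ?D"
        by (intro holomorphic_intros SD schwarz_majorant_holomorphic)
      show "(0::complex) islimpt of_real ` {-1<..<1::real}"
        unfolding islimpt_approachable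
      proof (intro allI impI)
        fix e :: real assume "e > 0"
        then show "\<exists>z\<in>complex_of_real ` {-1<..<1}. z \<noteq> 0 \<and> dist z 0 < e"
          by (intro bexI[of _ "of_real (min (e / 2) (1 / 2))"]) (auto simp: min_def)
      qed
      fix z :: complex assume "z \<in> of_real ` {-1<..<1}"
      then obtain x where x: "x \<in> {-1<..<1}" "z = of_real x" by blast
      have "p x = Q x" using no pQ x(1) by force
      then show "schwarzian f z - 2 * schwarz_majorant lam z = 0"
        using SQ[OF x(1)] by (simp add: x schwarz_majorant_of_real p_def)
    qed (use that in auto)
    then show False using ne by auto
  qed
  then obtain x0 where x0: "x0 \<in> {-1<..<1}" "p x0 < Q x0" by blast
  have D: "complex_of_real x \<in> ?D" if "x \<in> {-1<..<1}" for x using that by auto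
  define y where "y = comparison_solution lam"
  define y1 where "y1 = comparison_slope lam"
  \<comment> \<open>\<open>A\<close> and \<open>B\<close> solve the linear system that prescribes the value and the slope at \<open>x0\<close>;
     \<open>K\<close> is the value of \<open>A f + B\<close> there.\<close>
  define K where "K = of_real (y x0) / s x0"
  define A where "A = s x0 * (of_real (y1 x0) - K * s1 x0)"
  define B where "B = K - A * f x0"
  define v where "v x = (A * f (of_real x) + B) * s (of_real x)" for x :: real
  define v1 where
    "v1 x = A / s (of_real x) + (A * f (of_real x) + B) * s1 (of_real x)" for x :: real
  have sol: "((\<lambda>x. (A * f (of_real x) + B) * s (of_real x)) has_vector_derivative
        A / s (of_real x) + (A * f (of_real x) + B) * s1 (of_real x)) (at x)"
    "((\<lambda>x. A / s (of_real x) + (A * f (of_real x) + B) * s1 (of_real x)) has_vector_derivative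
        - of_real (Q x) * ((A * f (of_real x) + B) * s (of_real x))) (at x)"
    if "x \<in> {-1<..<1}" for x A B
    using schwarzian_linear_solution[OF fD open_ball D[OF that] s[OF D[OF that]], of A B]
    unfolding SQ[OF that] by (auto intro: has_vector_derivative_real_field)
  have init: "v x0 = of_real (y x0)" "v1 x0 = of_real (y1 x0)"
    using s(1)[OF D[OF x0(1)]] by (simp_all add: v_def v1_def B_def A_def K_def)
  have dv: "(v has_vector_derivative v1 x) (at x)"
    "(v1 has_vector_derivative - of_real (Q x) * v x) (at x)" if "x \<in> {-1<..<1}" for x
    using sol[OF that, of A B] unfolding v_def[abs_def] v1_def[abs_def] by auto
  have v_real: "v x \<in> \<real>" if x: "x \<in> {-1<..<1}" for x
  proof (rule real_solution_of_real_equation[OF dv sol[of _ 0 1] sol[of _ 1 0] _ _ x0(1) _ _ x])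
    fix t :: real assume "t \<in> {-1<..<1}"
    then show "(0 * f (of_real t) + 1) * s (of_real t)
        * (1 / s (of_real t) + (1 * f (of_real t) + 0) * s1 (of_real t))
      \<noteq> (0 / s (of_real t) + (0 * f (of_real t) + 1) * s1 (of_real t))
        * ((1 * f (of_real t) + 0) * s (of_real t))"
      using s(1)[OF D[of t]] by (simp add: field_simps)
  qed (auto simp: init)
  define V where "V x = Re (v x)" for x
  define V1 where "V1 x = Re (v1 x)" for x
  have dV: "(V has_real_derivative V1 x) (at x)"
    "(V1 has_real_derivative - Q x * V x) (at x)" if "x \<in> {-1<..<1}" for x
    using bounded_linear.has_vector_derivative[OF bounded_linear_Re dv(1)[OF that]]
      bounded_linear.has_vector_derivative[OF bounded_linear_Re dv(2)[OF that]]
    unfolding V_def[abs_def] V1_def[abs_def] has_real_derivative_iff_has_vector_derivative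
    by auto
  have dy: "(y has_real_derivative y1 x) (at x)" "(y1 has_real_derivative - p x * y x) (at x)"
    "y x > 0" "y x \<le> (exp lam * pi / 2) * (1 - x)" if "x \<in> {-1<..<1}" for x
    using that comparison_solution_deriv[of lam x] comparison_slope_deriv[of x lam]
      comparison_solution_pos[of x lam] comparison_solution_le_linear[of lam x, OF l0]
    unfolding y_def y1_def p_def by auto
  have V0: "V x0 = y x0" "V1 x0 = y1 x0" by (simp_all add: V_def V1_def init)
  have "\<exists>z. x0 < z \<and> z < 1 \<and> V z = 0"
    by (rule zero_to_the_right[of x0 1 V V1 Q y y1 p "exp lam * pi / 2"])
       (use x0 dV dy pQ V0 in auto)
  then obtain \<beta> where \<beta>: "x0 < \<beta>" "\<beta> < 1" "V \<beta> = 0" by blast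
  have "\<exists>z. - x0 < z \<and> z < 1 \<and> V (- z) = 0"
  proof (rule zero_to_the_right[of "- x0" 1 "\<lambda>x. V (- x)" "\<lambda>x. - V1 (- x)" "\<lambda>x. Q (- x)" y y1 p
        "exp lam * pi / 2"])
    fix x assume "x \<in> {- x0..<1}"
    then have x: "x \<in> {-1<..<1}" "- x \<in> {-1<..<1}" using x0 by auto
    have neg: "((\<lambda>x::real. - x) has_real_derivative - 1) (at x)"
      by (auto intro!: derivative_eq_intros)
    show "((\<lambda>x. V (- x)) has_real_derivative - V1 (- x)) (at x)"
      using DERIV_chain2[OF dV(1)[OF x(2)] neg] by simp
    show "((\<lambda>x. - V1 (- x)) has_real_derivative - Q (- x) * V (- x)) (at x)"
      using DERIV_minus[OF DERIV_chain2[OF dV(2)[OF x(2)] neg]] by simp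
    show "p x \<le> Q (- x)"
      using pQ[OF x(2)] schwarz_majorant_even[of lam x] by (simp add: p_def)
  qed (use x0 dy V0 in \<open>auto simp: y_def y1_def p_def comparison_solution_even
         comparison_slope_odd schwarz_majorant_even\<close>)
  then obtain \<alpha> where \<alpha>: "- x0 < \<alpha>" "\<alpha> < 1" "V (- \<alpha>) = 0" by blast
  have zeros: "A * f (of_real x) + B = 0" if "x \<in> {-1<..<1}" "V x = 0" for x
  proof -
    have "v x = 0" using v_real[OF that(1)] that(2) by (simp add: V_def complex_is_Real_iff complex_eq_iff)
    then show ?thesis using s(1)[OF D[OF that(1)]] by (simp add: v_def)
  qed
  have e: "A * f (of_real \<beta>) + B = 0" "A * f (of_real (- \<alpha>)) + B = 0"
    using zeros[of \<beta>] zeros[of "- \<alpha>"] \<alpha> \<beta> x0 by auto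
  have "A \<noteq> 0"
  proof
    assume "A = 0"
    then have "v x0 = 0" using e(1) by (simp add: v_def)
    then show False using init(1) dy(3)[OF x0(1)] by simp
  qed
  then have "f (of_real \<beta>) = f (of_real (- \<alpha>))" using e by (metis add_right_cancel mult_cancel_left)
  then have "complex_of_real \<beta> = of_real (- \<alpha>)"
    by (rule inj_onD[OF inj]) (use \<alpha> \<beta> x0 in auto)
  then have "\<beta> = - \<alpha>" using of_real_eq_iff by blast
  then show False using \<alpha> \<beta> by simp
qed

theorem theorem4:
  fixes lam :: real
  assumes "0 \<le> lam"
    and "lam \<le> (1/8) * ((4 + pi^2) - sqrt (16 + pi^4))"
  shows "(\<forall>f :: complex \<Rightarrow> complex.
            f analytic_on ball 0 1 \<longrightarrow>
            locally_univalent_on f (ball 0 1) \<longrightarrow>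
            (\<forall>z\<in>ball 0 1. cmod (schwarzian f z) \<le> 2 * schwarz_majorant lam (cmod z)) \<longrightarrow>
            inj_on f (ball 0 1))
         \<and> sharp_univalence_criterion lam"
  using univalence_criterion[OF assms] criterion_is_sharp[OF assms(1)] by blast

end
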